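(* For every $m\in\mathbb N$ there is a constant $C>0$ such that for every $n$ and every $m$-homogeneous polynomial $P(z)=\sum_{\mathbf j\in\mathcal J(m,n)}c_{\mathbf j}z_{j_1}\cdots z_{j_m}$ on $\mathbb C^n$, \[\big\|(c_{\mathbf j})_{\mathbf j\in\mathcal J(m,n)}\big\|_{\ell_{\frac{2m}{m+1},1}}\le C\|P\|_\infty;\] that is, $\mathrm{BH}^{\mathrm{pol}}_{\ell_{\frac{2m}{m+1},1}}(m)<\infty$.
   Context: $\mathcal J(m,n)=\{(j_1,\dots,j_m):1\le j_1\le\dots\le j_m\le n\}$; every $m$-homogeneous polynomial on $\mathbb C^n$ has a unique representation as displayed; $\|P\|_\infty=\sup_{z\in\mathbb C^n,\|z\|_\infty\le1}|P(z)|$. For a finite index set $I$ and $1<p<\infty$, $\|x\|_{\ell_{p,1}(I)}=\sum_k x_k^*(k^{1/p}-(k-1)^{1/p})$, where $x^*$ is the non-increasing rearrangement of $(|x_i|)_{i\in I}$. $\mathrm{BH}^{\mathrm{pol}}_X(m)$ is the best constant $C\ge 1$ in the displayed inequality with $\ell_{\frac{2m}{m+1},1}$ replaced by $X$. *)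

theory Defs
  imports "HOL-Analysis.Analysis" "HOL-Library.Multiset"
begin

definition J_idx :: "nat \<Rightarrow> nat \<Rightarrow> nat list set" where
  "J_idx m n = {j. length j = m \<and> sorted j \<and> set j \<subseteq> {1..n}}"

definition hom_poly :: "nat \<Rightarrow> nat \<Rightarrow> (nat list \<Rightarrow> complex) \<Rightarrow> (nat \<Rightarrow> complex) \<Rightarrow> complex" where
  "hom_poly m n c z = (\<Sum>j\<in>J_idx m n. c j * (\<Prod>k<m. z (j ! k)))"

definition poly_sup_norm :: "nat \<Rightarrow> nat \<Rightarrow> (nat list \<Rightarrow> complex) \<Rightarrow> real" where
  "poly_sup_norm m n c =
     (SUP z\<in>{z :: nat \<Rightarrow> complex. \<forall>i\<in>{1..n}. cmod (z i) \<le> 1}. cmod (hom_poly m n c z))"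

definition decr_rearr :: "'i set \<Rightarrow> ('i \<Rightarrow> complex) \<Rightarrow> real list" where
  "decr_rearr I x = rev (sorted_list_of_multiset (image_mset (\<lambda>i. cmod (x i)) (mset_set I)))"

text \<open>Lorentz norm \<parallel>x\<parallel>_{\<ell>_{p,1}(I)} = \<Sum>_k x^*_k (k^{1/p} - (k-1)^{1/p}), k = 1..|I|
  (0-based list index k corresponds to k+1).\<close>
definition lorentz_p1_norm :: "real \<Rightarrow> 'i set \<Rightarrow> ('i \<Rightarrow> complex) \<Rightarrow> real" where
  "lorentz_p1_norm p I x =
     (let xs = decr_rearr I x in
      \<Sum>k<length xs. xs ! k * (real (k + 1) powr (1 / p) - real k powr (1 / p)))"

end

(*
  Write g(i) for the l2-norm of the coefficients c_j with i occurring in j.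

  (1) sum_i g(i) <= C_m ||P||. By orthogonality of monomials, g(i) is at most the L2-norm on the
  torus of the partial derivative D_i P. On homogeneous polynomials of degree m - 1 the L2-norm is
  bounded by 2^(m-1) times the L1-norm: a monomial of f^2 splits in at most 4^(m-1) ways, which
  bounds the L4-norm by the L2-norm, and L2 interpolates between L1 and L4. Pointwise,
  sum_i |D_i P(z)| is, for a suitable w in the closed unit polydisc, the derivative at 0
  of t |-> P(z + t w), hence at most 2^m ||P|| by Cauchy's estimate.
  All averages are taken over N-th roots of unity, with N large enough for the degrees involved.

  (2) The Lorentz norm is bounded by a multiple of sum_i g(i). Order the variables so that g
  decreases, and group the indices j by the largest rank r of a variable occurring in j.
  Cauchy-Schwarz on each group gives a sum of g(r) v(r), where v(1)^2 + ... + v(R)^2 is the sum of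
  at most R^m squared Lorentz weights, hence at most m R. So v(1) + ... + v(R) <= sqrt m R, and
  summation by parts against the decreasing g finishes the proof.
*)
theory Submission
  imports Defs "HOL-Complex_Analysis.Complex_Analysis"
begin

subsection \<open>Homogeneous polynomials on the discrete torus\<close>

text \<open>Orthogonality of characters: multiplication by v = cis (2 pi / N) permutes the roots, so
  the sum S satisfies S = v^a * cnj v^b * S. For a \<noteq> b the factor differs from 1, as 0 < |a -
  b| < N and v is primitive; hence S = 0.\<close>

lemma sum_roots_unity_power_mult_cnj:
  assumes "a < N" "b < N"
  shows "(\<Sum>u\<in>{u::complex. u ^ N = 1}. u ^ a * cnj u ^ b) = (if a = b then of_nat N else 0)"
proof -
  let ?R = "{u::complex. u ^ N = 1}"
  let ?S = "\<Sum>u\<in>?R. u ^ a * cnj u ^ b"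
  have N: "N > 0" using assms by simp
  have unit: "u * cnj u = 1" if "u \<in> ?R" for u
  proof -
    have "norm u ^ N = 1" using that by (simp flip: norm_power)
    then have "norm u = 1" using N using power_eq_imp_eq_base[of "norm u" N 1] by simp
    then show ?thesis by (simp add: complex_norm_square[symmetric])
  qed
  show ?thesis
  proof (cases "a = b")
    case True
    have "?S = (\<Sum>u\<in>?R. 1)"
      by (rule sum.cong) (use unit True in \<open>simp_all flip: power_mult_distrib\<close>)
    then show ?thesis using True N by (simp add: card_roots_unity_eq)
  next
    case False
    define v where "v = cis (2 * pi / N)"
    have v: "v ^ N = 1" using N by (simp add: v_def Complex.DeMoivre)
    \<comment> \<open>\<open>v\<close> is primitive: otherwise d would be a positive multiple of N
      below N.\<close>
    have vpow: "v ^ d \<noteq> 1" if d: "0 < d" "d < N" for d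
    proof
      assume "v ^ d = 1"
      then have "cos (real d * (2 * pi / N)) = 1" by (simp add: v_def Complex.DeMoivre complex_eq_iff)
      then obtain k :: int where "real d * (2 * pi / N) = of_int k * 2 * pi"
        using cos_one_2pi_int by auto
      then have "real d = of_int k * N" using N by (simp add: field_simps)
      then have k: "int d = k * int N" by (metis of_int_eq_iff of_int_mult of_int_of_nat_eq)
      then have "0 < k * int N" using d by linarith
      then have "k \<ge> 1" using N by (simp add: zero_less_mult_iff)
      then have "k * int N \<ge> int N" using N by simp
      then show False using k d by linarith
    qed
    have bij: "bij_betw (\<lambda>u. v * u) ?R ?R"
    proof (rule bij_betwI[where g = "\<lambda>u. cnj v * u"])
      have cv: "cnj v ^ N = 1" using v by (metis complex_cnj_one complex_cnj_power)
      show "(\<lambda>u. v * u) \<in> ?R \<rightarrow> ?R" "(\<lambda>u. cnj v * u) \<in> ?R \<rightarrow> ?R"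
        using v cv by (simp_all add: power_mult_distrib)
      show "cnj v * (v * u) = u" "v * (cnj v * u) = u" for u
        using unit[of v] v by (simp_all add: mult.commute[of "cnj v"] flip: mult.assoc)
    qed
    have "?S = (\<Sum>u\<in>?R. (v * u) ^ a * cnj (v * u) ^ b)"
      by (rule sum.reindex_bij_betw[OF bij, symmetric])
    also have "\<dots> = (v ^ a * cnj v ^ b) * ?S"
      by (simp add: sum_distrib_left power_mult_distrib mult_ac)
    finally have eq: "?S = (v ^ a * cnj v ^ b) * ?S" .
    have "v ^ a * cnj v ^ b \<noteq> 1"
    proof
      assume 1: "v ^ a * cnj v ^ b = 1"
      have vc: "v ^ c * cnj v ^ c = 1" for c
        unfolding power_mult_distrib[symmetric] using unit[of v] v by simp
      consider "a < b" | "b < a" using False by linarith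
      then show False
      proof cases
        case 1
        then have "v ^ b = v ^ (b - a) * v ^ a" by (subst power_add[symmetric]) simp
        then have "v ^ (b - a) * (v ^ a * cnj v ^ b) = v ^ b * cnj v ^ b" by simp
        then show False using \<open>v ^ a * cnj v ^ b = 1\<close> vc vpow[of "b - a"] 1 assms by simp
      next
        case 2
        then have "v ^ a = v ^ (a - b) * v ^ b" by (subst power_add[symmetric]) simp
        then have "v ^ (a - b) * (v ^ b * cnj v ^ b) = v ^ a * cnj v ^ b" by simp
        then show False using 1 vc vpow[of "a - b"] 2 assms by simp
      qed
    qed
    then have "?S = 0" using iffD1[OF mult_cancel_right1 eq] by blast
    then show ?thesis using False by simp
  qed
qed

section \<open>Several variables: orthogonality of monomials and Parseval's identity\<close>

lemma prod_mset_eq_prod_count: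
  fixes z :: "'a \<Rightarrow> 'b::comm_monoid_mult"
  assumes "finite I" "set_mset M \<subseteq> I"
  shows "(\<Prod>i\<in>#M. z i) = (\<Prod>i\<in>I. z i ^ count M i)"
  unfolding image_prod_mset_multiplicity
  using assms by (intro prod.mono_neutral_left) (auto simp: not_in_iff)

text \<open>A finite stand-in for the polytorus: for products of a monomial and a conjugate monomial
  of degrees below N, averages over it agree with Haar integrals.\<close>

abbreviation torus :: "nat \<Rightarrow> 'a set \<Rightarrow> ('a \<Rightarrow> complex) set" where
  "torus N I \<equiv> PiE I (\<lambda>_. {u. u ^ N = 1})"

text \<open>The sum factors into one-variable sums. The size bounds keep every multiplicity below N,
  where one-variable orthogonality applies; for different multisets some factor vanishes.\<close>

lemma sum_torus_monomial_mult_cnj: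
  fixes M M' :: "'a multiset"
  assumes "finite I" "N > 0" "set_mset M \<subseteq> I" "set_mset M' \<subseteq> I" "size M < N" "size M' < N"
  shows "(\<Sum>z\<in>torus N I. (\<Prod>i\<in>#M. z i) * cnj (\<Prod>i\<in>#M'. z i)) =
    (if M = M' then of_nat N ^ card I else 0)"
proof -
  have lt: "count M i < N" "count M' i < N" for i
    using assms(5,6) count_le_size[of M i] count_le_size[of M' i] by linarith+
  have "(\<Sum>z\<in>torus N I. (\<Prod>i\<in>#M. z i) * cnj (\<Prod>i\<in>#M'. z i)) =
        (\<Sum>z\<in>torus N I. \<Prod>i\<in>I. z i ^ count M i * cnj (z i) ^ count M' i)"
    using assms by (simp add: prod_mset_eq_prod_count[of I] prod.distrib)
  also have "\<dots> = (\<Prod>i\<in>I. \<Sum>u\<in>{u. u ^ N = 1}. u ^ count M i * cnj u ^ count M' i)"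
    using assms by (intro prod_sum_PiE[symmetric]) (auto intro: finite_roots_unity)
  also have "\<dots> = (\<Prod>i\<in>I. if count M i = count M' i then of_nat N else 0)"
    using lt by (simp add: sum_roots_unity_power_mult_cnj)
  also have "\<dots> = (if M = M' then of_nat N ^ card I else 0)"
  proof (cases "M = M'")
    case False
    then obtain i where "count M i \<noteq> count M' i" by (meson multiset_eqI)
    moreover from this have "i \<in> I" using assms(3,4) by (metis not_in_iff subsetD)
    ultimately show ?thesis using assms(1) False by (auto intro!: prod_zero)
  qed simp
  finally show ?thesis .
qed

text \<open>Parseval's identity: once the squared modulus is expanded, orthogonality leaves only the
  diagonal terms.\<close>

lemma sum_torus_norm_square:
  fixes c :: "'a multiset \<Rightarrow> complex"
  assumes "finite I" "finite A" "N > 0" "\<And>M. M \<in> A \<Longrightarrow> set_mset M \<subseteq> I \<and> size M < N"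
  shows "(\<Sum>z\<in>torus N I. (cmod (\<Sum>M\<in>A. c M * (\<Prod>i\<in>#M. z i)))\<^sup>2) = real N ^ card I * (\<Sum>M\<in>A. (cmod (c M))\<^sup>2)"
proof -
  have "complex_of_real (\<Sum>z\<in>torus N I. (cmod (\<Sum>M\<in>A. c M * (\<Prod>i\<in>#M. z i)))\<^sup>2) =
    (\<Sum>z\<in>torus N I. \<Sum>M\<in>A. \<Sum>M'\<in>A. c M * cnj (c M') * ((\<Prod>i\<in>#M. z i) * cnj (\<Prod>i\<in>#M'. z i)))"
    by (simp only: of_real_sum complex_norm_square) (simp add: sum_product mult_ac)
  also have "\<dots> = (\<Sum>M\<in>A. \<Sum>M'\<in>A. c M * cnj (c M') * (\<Sum>z\<in>torus N I. (\<Prod>i\<in>#M. z i) * cnj (\<Prod>i\<in>#M'. z i)))"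
    by (simp add: sum_distrib_left sum.swap[of _ "torus N I"])
  also have "\<dots> = (\<Sum>M\<in>A. \<Sum>M'\<in>A. if M = M' then c M * cnj (c M') * of_nat N ^ card I else 0)"
    using assms by (intro sum.cong refl) (simp add: sum_torus_monomial_mult_cnj)
  also have "\<dots> = (\<Sum>M\<in>A. of_nat N ^ card I * (c M * cnj (c M)))"
    using assms(2) by (simp add: sum.delta mult_ac)
  also have "\<dots> = complex_of_real (real N ^ card I * (\<Sum>M\<in>A. (cmod (c M))\<^sup>2))"
    by (simp add: sum_distrib_left flip: complex_norm_square)
  finally show ?thesis by (simp only: of_real_eq_iff)
qed

section \<open>Comparison of the L1-, L2- and L4-norms of a homogeneous polynomial\<close>

lemma finite_card_submultisets:
  "finite {L. L \<subseteq># M} \<and> card {L. L \<subseteq># M} \<le> 2 ^ size M"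
proof (induction M)
  case (add x M)
  let ?B = "{L. L \<subseteq># M}"
  \<comment> \<open>A submultiset either omits \<open>x\<close>, and then lies in \<open>M\<close>,
    or is \<open>add_mset x\<close> of a submultiset of \<open>M\<close>; so the count at most
    doubles.\<close>
  have sub: "{L. L \<subseteq># add_mset x M} \<subseteq> ?B \<union> add_mset x ` ?B"
  proof
    fix L assume L: "L \<in> {L. L \<subseteq># add_mset x M}"
    show "L \<in> ?B \<union> add_mset x ` ?B"
    proof (cases "x \<in># L")
      case True
      then obtain L' where "L = add_mset x L'" by (metis insert_DiffM)
      then show ?thesis using L by auto
    next
      case False
      then have "count L a \<le> count M a" for a
        using mset_subset_eq_count[of L "add_mset x M" a] L by (cases "a = x") (auto simp: not_in_iff)
      then have "L \<subseteq># M" by (simp add: subseteq_mset_def)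
      then show ?thesis by simp
    qed
  qed
  have "card (?B \<union> add_mset x ` ?B) \<le> card ?B + card (add_mset x ` ?B)" by (rule card_Un_le)
  also have "\<dots> \<le> card ?B + card ?B" using add.IH card_image_le by (intro add_left_mono) blast
  also have "\<dots> \<le> 2 ^ size (add_mset x M)" using add.IH by simp
  finally have "card (?B \<union> add_mset x ` ?B) \<le> 2 ^ size (add_mset x M)" .
  moreover have fin: "finite (?B \<union> add_mset x ` ?B)" using add.IH by simp
  ultimately have "card {L. L \<subseteq># add_mset x M} \<le> 2 ^ size (add_mset x M)"
    using card_mono[OF fin sub] by linarith
  then show ?case using finite_subset[OF sub fin] by blast
qed simp

text \<open>Parseval is applied to f^2, whose degree 2k is below N. Each coefficient of f^2 is a sum
  over splittings of a monomial of degree 2k into two of degree k; there are at most 4^k of these,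
  and Cauchy-Schwarz costs this factor.\<close>

lemma sum_torus_norm_power4_le:
  fixes c :: "'a multiset \<Rightarrow> complex"
  assumes "finite I" "2 * k < N"
  shows "(\<Sum>z\<in>torus N I. cmod (\<Sum>M\<in>multisets_of_size I k. c M * (\<Prod>i\<in>#M. z i)) ^ 4)
    \<le> 4 ^ k * real N ^ card I * (\<Sum>M\<in>multisets_of_size I k. (cmod (c M))\<^sup>2)\<^sup>2"
proof -
  define A where "A = multisets_of_size I k"
  have finA: "finite A" using assms by (auto simp: A_def)
  \<comment> \<open>\<open>D\<close> collects the monomials of the square, \<open>F \<gamma>\<close>
    the ordered splittings of \<gamma>. These fibres partition the pairs, which \<open>UN\<close>
    records.\<close>
  define D where "D = (\<lambda>(\<alpha>, \<beta>). \<alpha> + \<beta>) ` (A \<times> A)"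
  define F where "F \<gamma> = {p \<in> A \<times> A. fst p + snd p = \<gamma>}" for \<gamma>
  define d where "d \<gamma> = (\<Sum>p\<in>F \<gamma>. c (fst p) * c (snd p))" for \<gamma>
  have finD: "finite D" using finA by (simp add: D_def)
  have finF: "finite (F \<gamma>)" for \<gamma> using finA by (simp add: F_def)
  have UN: "(\<Sum>\<gamma>\<in>D. sum h (F \<gamma>)) = sum h (A \<times> A)" for h :: "_ \<Rightarrow> 'z::comm_monoid_add"
    unfolding F_def using finA finD by (intro sum.group) (auto simp: D_def)
  have D: "set_mset \<gamma> \<subseteq> I \<and> size \<gamma> = 2 * k" if "\<gamma> \<in> D" for \<gamma>
    using that by (auto simp: D_def A_def multisets_of_size_def)
  have sq: "(\<Sum>M\<in>A. c M * (\<Prod>i\<in>#M. z i))\<^sup>2 = (\<Sum>\<gamma>\<in>D. d \<gamma> * (\<Prod>i\<in>#\<gamma>. z i))" for z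
  proof -
    have "(\<Sum>\<gamma>\<in>D. d \<gamma> * (\<Prod>i\<in>#\<gamma>. z i)) =
      (\<Sum>\<gamma>\<in>D. \<Sum>p\<in>F \<gamma>. c (fst p) * c (snd p) * ((\<Prod>i\<in>#fst p. z i) * (\<Prod>i\<in>#snd p. z i)))"
      unfolding d_def sum_distrib_right by (intro sum.cong refl) (auto simp: F_def)
    also have "\<dots> = (\<Sum>M\<in>A. c M * (\<Prod>i\<in>#M. z i))\<^sup>2"
      unfolding UN by (simp add: power2_eq_square sum_product sum.cartesian_product case_prod_unfold mult_ac)
    finally show ?thesis by simp
  qed
  have "(\<Sum>\<gamma>\<in>D. (cmod (d \<gamma>))\<^sup>2) \<le> (\<Sum>\<gamma>\<in>D. \<Sum>p\<in>F \<gamma>. 4 ^ k * (cmod (c (fst p)) * cmod (c (snd p)))\<^sup>2)"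
  proof (rule sum_mono)
    fix \<gamma> assume \<gamma>: "\<gamma> \<in> D"
    \<comment> \<open>A splitting is determined by its first part, a submultiset of
      \<gamma>.\<close>
    have "inj_on fst (F \<gamma>)" by (auto simp: inj_on_def F_def)
    moreover have "fst ` F \<gamma> \<subseteq> {L. L \<subseteq># \<gamma>}" by (auto simp: F_def)
    ultimately have "card (F \<gamma>) \<le> 2 ^ size \<gamma>"
      using finite_card_submultisets[of \<gamma>] by (meson card_inj_on_le order_trans)
    also have "\<dots> = 4 ^ k" using D[OF \<gamma>] by (simp add: power_mult)
    finally have "real (card (F \<gamma>)) \<le> 4 ^ k" by (metis of_nat_le_iff of_nat_numeral of_nat_power)
    moreover have "(cmod (d \<gamma>))\<^sup>2 \<le> (\<Sum>p\<in>F \<gamma>. cmod (c (fst p)) * cmod (c (snd p)))\<^sup>2"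
      unfolding d_def by (intro power_mono sum_norm_le) (auto simp: norm_mult)
    moreover have "\<dots> \<le> (\<Sum>p\<in>F \<gamma>. (cmod (c (fst p)) * cmod (c (snd p)))\<^sup>2) * card (F \<gamma>)"
      by (rule sum_squared_le_sum_of_squares)
    ultimately have "(cmod (d \<gamma>))\<^sup>2 \<le> (\<Sum>p\<in>F \<gamma>. (cmod (c (fst p)) * cmod (c (snd p)))\<^sup>2) * 4 ^ k"
      by (meson mult_left_mono order_trans sum_nonneg zero_le_power2)
    then show "(cmod (d \<gamma>))\<^sup>2 \<le> (\<Sum>p\<in>F \<gamma>. 4 ^ k * (cmod (c (fst p)) * cmod (c (snd p)))\<^sup>2)"
      by (simp add: sum_distrib_left mult.commute)
  qed
  also have "\<dots> = 4 ^ k * (\<Sum>M\<in>A. (cmod (c M))\<^sup>2)\<^sup>2"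
  proof -
    have "(\<Sum>M\<in>A. (cmod (c M))\<^sup>2)\<^sup>2 = (\<Sum>p\<in>A \<times> A. (cmod (c (fst p)))\<^sup>2 * (cmod (c (snd p)))\<^sup>2)"
      unfolding power2_eq_square[of "sum _ _"] sum_product sum.cartesian_product
      by (simp only: case_prod_unfold)
    then show ?thesis
      unfolding UN by (simp add: power_mult_distrib flip: sum_distrib_left)
  qed
  finally have d: "(\<Sum>\<gamma>\<in>D. (cmod (d \<gamma>))\<^sup>2) \<le> 4 ^ k * (\<Sum>M\<in>A. (cmod (c M))\<^sup>2)\<^sup>2" .
  have "(\<Sum>z\<in>torus N I. cmod (\<Sum>M\<in>A. c M * (\<Prod>i\<in>#M. z i)) ^ 4) =
    (\<Sum>z\<in>torus N I. (cmod (\<Sum>\<gamma>\<in>D. d \<gamma> * (\<Prod>i\<in>#\<gamma>. z i)))\<^sup>2)"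
    unfolding sq[symmetric] by (simp add: norm_power flip: power_mult)
  also have "\<dots> = real N ^ card I * (\<Sum>\<gamma>\<in>D. (cmod (d \<gamma>))\<^sup>2)"
    using assms finD D by (intro sum_torus_norm_square) auto
  also have "\<dots> \<le> real N ^ card I * (4 ^ k * (\<Sum>M\<in>A. (cmod (c M))\<^sup>2)\<^sup>2)"
    using d by (intro mult_left_mono) auto
  finally show ?thesis by (simp add: A_def mult_ac)
qed

text \<open>Interpolation between L1 and L4: two uses of Cauchy-Schwarz give S2^2 \<le> S1 S3 and
  S3^2 \<le> S2 S4, hence S2^4 \<le> S1^2 S2 S4. Parseval evaluates S2, and S4 is bounded by the
  L2-norm.\<close>

lemma L2_le_L1_torus:
  fixes c :: "'a multiset \<Rightarrow> complex"
  assumes "finite I" "2 * k < N"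
  shows "real N ^ card I * sqrt (\<Sum>M\<in>multisets_of_size I k. (cmod (c M))\<^sup>2)
    \<le> 2 ^ k * (\<Sum>z\<in>torus N I. cmod (\<Sum>M\<in>multisets_of_size I k. c M * (\<Prod>i\<in>#M. z i)))"
proof -
  define f where "f z = cmod (\<Sum>M\<in>multisets_of_size I k. c M * (\<Prod>i\<in>#M. z i))" for z
  define s where "s = (\<Sum>M\<in>multisets_of_size I k. (cmod (c M))\<^sup>2)"
  define q where "q = real N ^ card I"
  define S where "S e = (\<Sum>z\<in>torus N I. f z ^ e)" for e
  have f0: "f z \<ge> 0" for z by (simp add: f_def)
  have s0: "s \<ge> 0" by (simp add: s_def sum_nonneg)
  have q0: "q > 0" using assms by (simp add: q_def)
  have S0: "S e \<ge> 0" for e by (simp add: S_def f0 sum_nonneg)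
  have S2: "S 2 = q * s"
    unfolding S_def f_def q_def s_def using assms
    by (intro sum_torus_norm_square finite_multisets_of_size) (auto simp: multisets_of_size_def)
  have S4: "S 4 \<le> 4 ^ k * q * s\<^sup>2"
    unfolding S_def f_def q_def s_def using assms by (rule sum_torus_norm_power4_le)
  have S13: "(S 2)\<^sup>2 \<le> S 1 * S 3"
  proof -
    have "sqrt (f z) * sqrt (f z ^ 3) = (f z)\<^sup>2" for z
      unfolding real_sqrt_mult[symmetric] by (rule real_sqrt_unique) (simp_all add: eval_nat_numeral)
    then have "(S 2)\<^sup>2 = (\<Sum>z\<in>torus N I. sqrt (f z) * sqrt (f z ^ 3))\<^sup>2"
      by (simp add: S_def)
    also have "\<dots> \<le> (\<Sum>z\<in>torus N I. (sqrt (f z))\<^sup>2) * (\<Sum>z\<in>torus N I. (sqrt (f z ^ 3))\<^sup>2)"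
      by (rule Cauchy_Schwarz_ineq_sum)
    finally show ?thesis by (simp add: S_def f0)
  qed
  have S24: "(S 3)\<^sup>2 \<le> S 2 * S 4"
    using Cauchy_Schwarz_ineq_sum[of f "\<lambda>z. (f z)\<^sup>2" "torus N I"]
    by (simp add: S_def eval_nat_numeral mult_ac)
  have "(q * s) ^ 4 = ((S 2)\<^sup>2)\<^sup>2" by (simp add: S2 flip: power_mult)
  also have "\<dots> \<le> (S 1 * S 3)\<^sup>2" using S13 by (intro power_mono) auto
  also have "\<dots> = (S 1)\<^sup>2 * (S 3)\<^sup>2" by (simp add: power_mult_distrib)
  also have "\<dots> \<le> (S 1)\<^sup>2 * (S 2 * S 4)" using S24 by (intro mult_left_mono) auto
  also have "\<dots> \<le> (S 1)\<^sup>2 * (S 2 * (4 ^ k * q * s\<^sup>2))" using S4 S0 by (intro mult_left_mono) auto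
  finally have *: "(q * s) ^ 4 \<le> (S 1)\<^sup>2 * (q * s * (4 ^ k * q * s\<^sup>2))" by (simp add: S2)
  have "q * sqrt s \<le> 2 ^ k * S 1"
  proof (cases "s = 0")
    case False
    then have s: "s > 0" using s0 by simp
    \<comment> \<open>The common factor q^2 s^3 is positive in this case; cancelling it leaves the
      square of the claim.\<close>
    have "(q\<^sup>2 * s ^ 3) * (q\<^sup>2 * s) \<le> (q\<^sup>2 * s ^ 3) * (4 ^ k * (S 1)\<^sup>2)"
      using * by (simp add: eval_nat_numeral algebra_simps)
    then have "q\<^sup>2 * s \<le> 4 ^ k * (S 1)\<^sup>2"
      using s q0 by (subst (asm) mult_le_cancel_left_pos) auto
    also have "(4::real) ^ k = (2 ^ k)\<^sup>2"
      by (simp add: power2_eq_square flip: power_mult_distrib)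
    also have "(2 ^ k)\<^sup>2 * (S 1)\<^sup>2 = (2 ^ k * S 1)\<^sup>2" by (simp only: power_mult_distrib)
    finally have "(q * sqrt s)\<^sup>2 \<le> (2 ^ k * S 1)\<^sup>2" using s0 by (simp add: power_mult_distrib)
    then show ?thesis using S0 by (intro power2_le_imp_le[of "q * sqrt s" "2 ^ k * S 1"]) simp_all
  qed (use S0 in simp)
  then show ?thesis by (simp add: q_def s_def S_def f_def)
qed

subsection \<open>Mixed norm estimate\<close>

text \<open>Leibniz rule along the line z + t w. The sum runs over the multiset, so a repeated
  variable contributes once per occurrence.\<close>

lemma has_field_derivative_prod_mset_affine:
  fixes z w :: "'a \<Rightarrow> 'b::real_normed_field"
  shows "((\<lambda>t. \<Prod>i\<in>#M. z i + t * w i) has_field_derivative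
    (\<Sum>i\<in>#M. w i * (\<Prod>j\<in>#M - {#i#}. z j + t * w j))) (at t)"
proof (induction M)
  case (add a M)
  \<comment> \<open>For i in M, a copy of a survives the removal of i from
    \<open>add_mset a M\<close>, even when i = a, so its factor can be pulled out.\<close>
  have eq: "{#w i * (\<Prod>j\<in>#add_mset a M - {#i#}. z j + t * w j). i \<in># M#}
    = {#(z a + t * w a) * (w i * (\<Prod>j\<in>#M - {#i#}. z j + t * w j)). i \<in># M#}"
    by (rule image_mset_cong) (auto dest!: multi_member_split simp: add_mset_commute[of a] mult_ac)
  have "((\<lambda>t. (z a + t * w a) * (\<Prod>i\<in>#M. z i + t * w i)) has_field_derivative
     w a * (\<Prod>i\<in>#M. z i + t * w i) + (z a + t * w a) * (\<Sum>i\<in>#M. w i * (\<Prod>j\<in>#M - {#i#}. z j + t * w j))) (at t)"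
    by (auto intro!: derivative_eq_intros add.IH simp: algebra_simps)
  then show ?case by (simp add: eq sum_mset_distrib_left)
qed simp

lemma sum_mset_eq_sum_count:
  fixes f :: "'a \<Rightarrow> 'b::semiring_1"
  assumes "finite I" "set_mset M \<subseteq> I"
  shows "(\<Sum>i\<in>#M. f i) = (\<Sum>i\<in>I. of_nat (count M i) * f i)"
  using assms(2)
proof (induction M)
  case (add a M)
  then have "(\<Sum>i\<in>I. of_nat (count (add_mset a M) i) * f i) = (\<Sum>i\<in>I. (if i = a then f i else 0) + of_nat (count M i) * f i)"
    by (intro sum.cong) (auto simp: algebra_simps)
  then show ?case using add assms(1) by (simp add: sum.distrib)
qed simp

text \<open>Indexes the monomials containing the variable i by the monomials of the partial
  derivative D_i P; the inverse removes one copy of i.\<close>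

lemma bij_betw_add_mset_multisets_of_size:
  assumes "i \<in> I"
  shows "bij_betw (add_mset i) (multisets_of_size I k) {M \<in> multisets_of_size I (Suc k). i \<in># M}"
  by (rule bij_betwI[where g = "\<lambda>M. M - {#i#}"])
     (use assms in \<open>auto simp: multisets_of_size_def size_Diff_singleton dest: in_diffD\<close>)

text \<open>The inner sum is D_i P(z): its monomial M comes from \<open>add_mset i M\<close>, in
  which i has exponent \<open>Suc (count M i)\<close>. A direction w with w_i D_i P(z) = |D_i P(z)|
  turns the sum of moduli into one directional derivative, to which Cauchy's estimate
  applies.\<close>

lemma sum_cmod_partial_derivatives_le:
  fixes c :: "'a multiset \<Rightarrow> complex"
  assumes "finite I"
    and bound: "\<And>z. (\<And>i. i \<in> I \<Longrightarrow> cmod (z i) \<le> 1) \<Longrightarrow>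
      cmod (\<Sum>M\<in>multisets_of_size I (Suc k). c M * (\<Prod>i\<in>#M. z i)) \<le> B"
    and z: "\<And>i. i \<in> I \<Longrightarrow> cmod (z i) \<le> 1"
  shows "(\<Sum>i\<in>I. cmod (\<Sum>M\<in>multisets_of_size I k. of_nat (Suc (count M i)) * c (add_mset i M) * (\<Prod>j\<in>#M. z j)))
    \<le> 2 ^ Suc k * B"
proof -
  define A where "A = multisets_of_size I (Suc k)"
  have finA: "finite A" using assms(1) by (auto simp: A_def)
  have A: "set_mset M \<subseteq> I" "size M = Suc k" if "M \<in> A" for M
    using that by (auto simp: A_def multisets_of_size_def)
  define D where "D i = (\<Sum>M\<in>multisets_of_size I k. of_nat (Suc (count M i)) * c (add_mset i M) * (\<Prod>j\<in>#M. z j))" for i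
  define w where "w i = cnj (sgn (D i))" for i
  have w1: "cmod (w i) \<le> 1" for i by (simp add: w_def norm_sgn)
  have wD: "w i * D i = cmod (D i)" for i
  proof (cases "D i = 0")
    case False
    have "w i * D i = of_real (inverse (cmod (D i))) * (D i * cnj (D i))"
      by (simp add: w_def sgn_div_norm scaleR_conv_of_real mult_ac)
    also have "\<dots> = cmod (D i)"
      using False by (simp add: complex_norm_square[symmetric] power2_eq_square)
    finally show ?thesis .
  qed simp
  define f where "f t = (\<Sum>M\<in>A. c M * (\<Prod>i\<in>#M. z i + t * w i))" for t
  have der: "(f has_field_derivative (\<Sum>M\<in>A. c M * (\<Sum>i\<in>#M. w i * (\<Prod>j\<in>#M - {#i#}. z j + t * w j)))) (at t)" for t
    unfolding f_def by (intro DERIV_sum DERIV_cmult has_field_derivative_prod_mset_affine)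
  have hol: "f holomorphic_on S" for S
    using der by (meson field_differentiable_at_within field_differentiable_def holomorphic_on_def)
  have "deriv f 0 = (\<Sum>M\<in>A. c M * (\<Sum>i\<in>#M. w i * (\<Prod>j\<in>#M - {#i#}. z j)))"
    using DERIV_imp_deriv[OF der[of 0]] by simp
  also have "\<dots> = (\<Sum>M\<in>A. \<Sum>i\<in>I. w i * (of_nat (count M i) * c M * (\<Prod>j\<in>#M - {#i#}. z j)))"
    using A assms(1) by (intro sum.cong refl) (simp add: sum_mset_eq_sum_count[of I] sum_distrib_left mult_ac)
  also have "\<dots> = (\<Sum>i\<in>I. w i * (\<Sum>M\<in>A. of_nat (count M i) * c M * (\<Prod>j\<in>#M - {#i#}. z j)))"
    by (subst sum.swap) (simp add: sum_distrib_left)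
  also have "\<dots> = (\<Sum>i\<in>I. w i * D i)"
  proof (intro sum.cong refl arg_cong2[where f = times])
    fix i assume i: "i \<in> I"
    \<comment> \<open>Monomials without i carry the factor 0; the others are reindexed as
      \<open>add_mset i M\<close>.\<close>
    have "(\<Sum>M\<in>A. of_nat (count M i) * c M * (\<Prod>j\<in>#M - {#i#}. z j)) =
      (\<Sum>M\<in>{M\<in>A. i \<in># M}. of_nat (count M i) * c M * (\<Prod>j\<in>#M - {#i#}. z j))"
      using finA by (intro sum.mono_neutral_right) (auto simp: not_in_iff)
    also have "\<dots> = D i"
      unfolding D_def A_def
      by (subst sum.reindex_bij_betw[OF bij_betw_add_mset_multisets_of_size[OF i, of k], symmetric]) simp
    finally show "(\<Sum>M\<in>A. of_nat (count M i) * c M * (\<Prod>j\<in>#M - {#i#}. z j)) = D i" .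
  qed
  also have "\<dots> = of_real (\<Sum>i\<in>I. cmod (D i))" by (simp add: wD)
  finally have d0: "deriv f 0 = of_real (\<Sum>i\<in>I. cmod (D i))" .
  have fB: "cmod (f t) \<le> 2 ^ Suc k * B" if "cmod (0 - t) = 1" for t
  proof -
    \<comment> \<open>For |t| = 1 the point z + t w lies in the polydisc of radius 2. Halving it
      returns to the unit polydisc, and homogeneity of degree k + 1 gives the factor
      2^(k+1).\<close>
    define u where "u i = (z i + t * w i) / 2" for i
    have "cmod (u i) \<le> 1" if "i \<in> I" for i
    proof -
      have "cmod (z i + t * w i) \<le> cmod (z i) + cmod (t * w i)" by (rule norm_triangle_ineq)
      also have "\<dots> \<le> 2" using z[OF that] w1[of i] \<open>cmod (0 - t) = 1\<close> by (simp add: norm_mult)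
      finally show ?thesis by (simp add: u_def norm_divide)
    qed
    then have "cmod (\<Sum>M\<in>A. c M * (\<Prod>i\<in>#M. u i)) \<le> B" unfolding A_def by (rule bound)
    moreover have "f t = 2 ^ Suc k * (\<Sum>M\<in>A. c M * (\<Prod>i\<in>#M. u i))"
      unfolding f_def sum_distrib_left
    proof (rule sum.cong)
      fix M assume M: "M \<in> A"
      have "(\<Prod>i\<in>#M. z i + t * w i) = (\<Prod>i\<in>#M. 2 * u i)"
        by (rule arg_cong[where f = prod_mset], rule image_mset_cong) (simp add: u_def)
      also have "\<dots> = 2 ^ size M * (\<Prod>i\<in>#M. u i)" by (simp add: prod_mset.distrib)
      finally show "c M * (\<Prod>i\<in>#M. z i + t * w i) = 2 ^ Suc k * (c M * (\<Prod>i\<in>#M. u i))"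
        using A[OF M] by (simp add: mult_ac)
    qed simp
    ultimately show ?thesis by (simp add: norm_mult norm_power)
  qed
  have "cmod ((deriv ^^ 1) f 0) \<le> fact 1 * (2 ^ Suc k * B) / 1 ^ 1"
    by (rule Cauchy_inequality[where r = 1]) (use fB hol in \<open>auto intro: holomorphic_on_imp_continuous_on\<close>)
  then have "cmod (deriv f 0) \<le> 2 ^ Suc k * B" by simp
  then have "(\<Sum>i\<in>I. cmod (D i)) \<le> 2 ^ Suc k * B"
    unfolding d0 norm_of_real by linarith
  then show ?thesis by (simp add: D_def)
qed

text \<open>The L2-norm of each D_i P is at most 2^k times its mean modulus. Exchanging the sums
  over i and z brings in the pointwise bound 2^(k+1) B, and the two factors make 2 * 4^k.\<close>

lemma sum_sliced_L2_le_sup: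
  fixes c :: "'a multiset \<Rightarrow> complex"
  assumes "finite I"
    and bound: "\<And>z. (\<And>i. i \<in> I \<Longrightarrow> cmod (z i) \<le> 1) \<Longrightarrow>
      cmod (\<Sum>M\<in>multisets_of_size I (Suc k). c M * (\<Prod>i\<in>#M. z i)) \<le> B"
  shows "(\<Sum>i\<in>I. sqrt (\<Sum>M\<in>{M\<in>multisets_of_size I (Suc k). i \<in># M}. (cmod (c M))\<^sup>2)) \<le> 2 * 4 ^ k * B"
proof -
  \<comment> \<open>The least N with 2k < N, as the L2-L1 comparison in degree k requires.\<close>
  define N where "N = 2 * k + 1"
  define q where "q = real N ^ card I"
  have q: "q > 0" by (simp add: q_def N_def)
  define d where "d i M = of_nat (Suc (count M i)) * c (add_mset i M)" for i M
  define D where "D i z = cmod (\<Sum>M\<in>multisets_of_size I k. d i M * (\<Prod>j\<in>#M. z j))" for i z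
  have slice: "q * sqrt (\<Sum>M\<in>{M\<in>multisets_of_size I (Suc k). i \<in># M}. (cmod (c M))\<^sup>2)
      \<le> 2 ^ k * (\<Sum>z\<in>torus N I. D i z)" if i: "i \<in> I" for i
  proof -
    have "(\<Sum>M\<in>{M\<in>multisets_of_size I (Suc k). i \<in># M}. (cmod (c M))\<^sup>2)
        = (\<Sum>M\<in>multisets_of_size I k. (cmod (c (add_mset i M)))\<^sup>2)"
      by (rule sum.reindex_bij_betw[OF bij_betw_add_mset_multisets_of_size[OF i], symmetric])
    \<comment> \<open>Differentiation multiplies each coefficient by an exponent that is at least
      1.\<close>
    also have "\<dots> \<le> (\<Sum>M\<in>multisets_of_size I k. (cmod (d i M))\<^sup>2)"
    proof (intro sum_mono power_mono)
      fix M
      have "1 * cmod (c (add_mset i M)) \<le> real (Suc (count M i)) * cmod (c (add_mset i M))"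
        by (intro mult_right_mono) auto
      then show "cmod (c (add_mset i M)) \<le> cmod (d i M)" by (simp only: d_def norm_mult norm_of_nat mult_1)
    qed simp
    finally have "q * sqrt (\<Sum>M\<in>{M\<in>multisets_of_size I (Suc k). i \<in># M}. (cmod (c M))\<^sup>2)
        \<le> q * sqrt (\<Sum>M\<in>multisets_of_size I k. (cmod (d i M))\<^sup>2)"
      using q by simp
    also have "\<dots> \<le> 2 ^ k * (\<Sum>z\<in>torus N I. D i z)"
      unfolding q_def D_def using assms(1) by (intro L2_le_L1_torus) (simp_all add: N_def)
    finally show ?thesis .
  qed
  have "q * (\<Sum>i\<in>I. sqrt (\<Sum>M\<in>{M\<in>multisets_of_size I (Suc k). i \<in># M}. (cmod (c M))\<^sup>2))
      \<le> (\<Sum>i\<in>I. 2 ^ k * (\<Sum>z\<in>torus N I. D i z))"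
    by (subst sum_distrib_left) (rule sum_mono, rule slice)
  also have "\<dots> = 2 ^ k * (\<Sum>z\<in>torus N I. \<Sum>i\<in>I. D i z)"
    by (subst sum.swap) (simp add: sum_distrib_left)
  also have "\<dots> \<le> 2 ^ k * (\<Sum>z\<in>torus N I. 2 ^ Suc k * B)"
  proof (intro mult_left_mono sum_mono)
    fix z assume z: "z \<in> torus N I"
    have "cmod (z i) \<le> 1" if "i \<in> I" for i
    proof -
      have "z i ^ N = 1" using z that by (auto simp: PiE_iff)
      then have "cmod (z i) ^ N = 1" by (simp flip: norm_power)
      then show ?thesis using power_eq_imp_eq_base[of "cmod (z i)" N 1] by (simp add: N_def)
    qed
    then show "(\<Sum>i\<in>I. D i z) \<le> 2 ^ Suc k * B"
      unfolding D_def d_def by (intro sum_cmod_partial_derivatives_le assms) auto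
  qed simp
  also have "\<dots> = q * (2 * 4 ^ k * B)"
  proof -
    have "real (card (torus N I)) = q"
      using assms(1) card_roots_unity_eq[of N] by (simp add: card_PiE q_def) (simp add: N_def)
    moreover have "(4::real) ^ k = 2 ^ k * 2 ^ k" by (simp flip: power_mult_distrib)
    ultimately show ?thesis by simp
  qed
  finally show ?thesis using q by (simp only: mult_le_cancel_left_pos)
qed

subsection \<open>Lorentz weights\<close>

text \<open>Induction by removing the maximum: among d + 1 naturals the maximum is at least d, so f
  there is at most f d.\<close>

lemma antitone_sum_le_initial_segment:
  fixes f :: "nat \<Rightarrow> real"
  assumes "antimono f" "finite A"
  shows "sum f A \<le> (\<Sum>k<card A. f k)"
  using assms(2)
proof (induction "card A" arbitrary: A)
  case 0
  then show ?case by simp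
next
  case (Suc d)
  let ?M = "Max A"
  have ne: "A \<noteq> {}" using Suc.hyps(2) by auto
  then have M: "?M \<in> A" using Suc.prems by simp
  have d: "card (A - {?M}) = d" using Suc M by simp
  have "A - {?M} \<subseteq> {..<?M}" using Suc.prems by (auto simp: order_less_le)
  then have "d \<le> ?M" using d card_mono[of "{..<?M}" "A - {?M}"] by simp
  then have "f ?M \<le> f d" using assms(1) by (simp add: antimono_def)
  moreover have "sum f (A - {?M}) \<le> (\<Sum>k<d. f k)"
    using Suc.hyps(1)[of "A - {?M}"] d Suc.prems by simp
  moreover have "sum f A = f ?M + sum f (A - {?M})"
    using Suc.prems M by (rule sum.remove)
  ultimately show ?case by (simp flip: Suc.hyps(2))
qed

lemma antitone_sum_mult_nonneg:
  fixes g u :: "nat \<Rightarrow> real"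
  assumes "\<And>i j. i \<le> j \<Longrightarrow> j < n \<Longrightarrow> g j \<le> g i" "\<And>i. i < n \<Longrightarrow> g i \<ge> 0"
    and "\<And>R. R \<le> n \<Longrightarrow> (\<Sum>r<R. u r) \<ge> 0"
  shows "(\<Sum>r<n. g r * u r) \<ge> 0"
proof -
  \<comment> \<open>Summation by parts as a stronger invariant: the weighted partial sum dominates
    the plain one times the last, smallest, value of g.\<close>
  have "(\<Sum>r<Suc R. g r * u r) \<ge> g R * (\<Sum>r<Suc R. u r)" if "Suc R \<le> n" for R
    using that
  proof (induction R)
    case (Suc R)
    have "g (Suc R) * (\<Sum>r<Suc R. u r) \<le> g R * (\<Sum>r<Suc R. u r)"
      using assms(1)[of R "Suc R"] assms(3)[of "Suc R"] Suc.prems by (intro mult_right_mono) auto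
    moreover have "g R * (\<Sum>r<Suc R. u r) \<le> (\<Sum>r<Suc R. g r * u r)"
      using Suc by simp
    ultimately show ?case by (simp add: distrib_left)
  qed simp
  moreover have "g R * (\<Sum>r<Suc R. u r) \<ge> 0" if "Suc R \<le> n" for R
    using assms(2)[of R] assms(3)[OF that] that by simp
  ultimately show ?thesis
    by (cases n) (auto simp del: sum.lessThan_Suc intro: order_trans)
qed

text \<open>Variables are ranked by decreasing slice norm g, and each j joins the block of its last
  variable. Cauchy-Schwarz on a block gives g times the l2-norm v of its weights. The hypothesis on
  w, for initial segments of the ranking, controls the partial sums of v, and summation by parts
  replaces v by sqrt K.\<close>

lemma sum_mult_le_sum_sliced_L2:
  fixes a w :: "'j \<Rightarrow> real" and K :: real
  assumes "finite I" "finite J" and S: "\<And>j. j \<in> J \<Longrightarrow> S j \<noteq> {} \<and> S j \<subseteq> I"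
    and w: "\<And>U. U \<subseteq> I \<Longrightarrow> (\<Sum>j\<in>{j\<in>J. S j \<subseteq> U}. (w j)\<^sup>2) \<le> K * card U"
    and nonneg: "\<And>j. j \<in> J \<Longrightarrow> a j * w j \<ge> 0"
    and "K \<ge> 0"
  shows "(\<Sum>j\<in>J. a j * w j) \<le> sqrt K * (\<Sum>i\<in>I. sqrt (\<Sum>j\<in>{j\<in>J. i \<in> S j}. (a j)\<^sup>2))"
proof -
  define g where "g i = sqrt (\<Sum>j\<in>{j\<in>J. i \<in> S j}. (a j)\<^sup>2)" for i
  obtain l where l: "set l = I" "distinct l" using finite_distinct_list[OF \<open>finite I\<close>] by blast
  define il where "il = rev (sort_key g l)"
  define n where "n = length il"
  have il: "set il = I" "distinct il" using l by (auto simp: il_def)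
  have desc: "g (il ! j) \<le> g (il ! i)" if "i \<le> j" "j < n" for i j
  proof -
    have "sorted (rev (map g il))" by (simp add: il_def flip: rev_map)
    then show ?thesis using that by (auto simp: n_def sorted_rev_iff_nth_mono)
  qed
  \<comment> \<open>The block of those j whose last variable in this order is
    \<open>il ! r\<close>.\<close>
  define E where "E r = {j\<in>J. il ! r \<in> S j \<and> S j \<subseteq> set (take (Suc r) il)}" for r
  define W where "W r = (\<Sum>j\<in>E r. (w j)\<^sup>2)" for r
  define v where "v r = sqrt (W r)" for r
  have finE: "finite (E r)" for r using \<open>finite J\<close> by (simp add: E_def)
  have W0: "W r \<ge> 0" for r by (simp add: W_def sum_nonneg)
  have cover: "J \<subseteq> (\<Union>r<n. E r)"
  proof
    fix j assume j: "j \<in> J"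
    define T where "T = {r. r < n \<and> il ! r \<in> S j}"
    have T: "finite T" "T \<noteq> {}" using S[OF j] il by (auto simp: T_def n_def in_set_conv_nth subset_iff) (metis in_set_conv_nth)
    have "Max T \<in> T" using T by simp
    moreover have "S j \<subseteq> set (take (Suc (Max T)) il)"
    proof
      fix i assume i: "i \<in> S j"
      then obtain r where r: "r < n" "il ! r = i" using S[OF j] il by (metis in_set_conv_nth n_def subsetD)
      then have "r \<le> Max T" using T i by (simp add: T_def)
      then show "i \<in> set (take (Suc (Max T)) il)" using r
        by (auto simp: in_set_conv_nth n_def intro!: exI[of _ r])
    qed
    ultimately show "j \<in> (\<Union>r<n. E r)" using j by (auto simp: E_def T_def)
  qed
  have disj: "E r \<inter> E s = {}" if "r < s" "s < n" for r s
  proof -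
    have "il ! s \<notin> set (take (Suc r) il)"
      using that il(2) by (auto simp: in_set_conv_nth n_def nth_eq_iff_index_eq)
    then show ?thesis by (auto simp: E_def)
  qed
  have "(\<Sum>j\<in>J. a j * w j) \<le> (\<Sum>j\<in>(\<Union>r<n. E r). a j * w j)"
    using cover nonneg finE by (intro sum_mono2) (auto simp: E_def)
  also have "\<dots> = (\<Sum>r<n. \<Sum>j\<in>E r. a j * w j)"
    using finE disj by (intro sum.UNION_disjoint) (auto, metis disjoint_iff linorder_neqE_nat)
  also have "\<dots> \<le> (\<Sum>r<n. g (il ! r) * v r)"
  proof (rule sum_mono)
    fix r assume "r \<in> {..<n}"
    have "(\<Sum>j\<in>E r. a j * w j)\<^sup>2 \<le> (\<Sum>j\<in>E r. (a j)\<^sup>2) * W r"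
      unfolding W_def by (rule Cauchy_Schwarz_ineq_sum)
    \<comment> \<open>Dropping the restriction to the initial segment enlarges the block to the full
      slice at \<open>il ! r\<close>.\<close>
    also have "\<dots> \<le> (\<Sum>j\<in>{j\<in>J. il ! r \<in> S j}. (a j)\<^sup>2) * W r"
      using \<open>finite J\<close> W0 by (intro mult_right_mono sum_mono2) (auto simp: E_def)
    finally have "\<bar>\<Sum>j\<in>E r. a j * w j\<bar> \<le> g (il ! r) * v r"
      unfolding g_def v_def by (metis real_sqrt_abs real_sqrt_le_iff real_sqrt_mult)
    then show "(\<Sum>j\<in>E r. a j * w j) \<le> g (il ! r) * v r" by linarith
  qed
  also have "\<dots> \<le> (\<Sum>r<n. g (il ! r) * sqrt K)"
  proof -
    have "0 \<le> (\<Sum>r<n. g (il ! r) * (sqrt K - v r))"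
    proof (rule antitone_sum_mult_nonneg)
      show "g (il ! i) \<ge> 0" for i by (simp add: g_def sum_nonneg)
      fix R assume R: "R \<le> n"
      have "(\<Sum>r<R. W r) = (\<Sum>j\<in>(\<Union>r<R. E r). (w j)\<^sup>2)"
        unfolding W_def using finE disj R
        by (intro sum.UNION_disjoint[symmetric]) (auto, metis disjoint_iff linorder_neqE_nat order.strict_trans2)
      \<comment> \<open>The blocks below R involve only the first R variables, which serve as U in
        the hypothesis on \<open>w\<close>.\<close>
      also have "\<dots> \<le> (\<Sum>j\<in>{j\<in>J. S j \<subseteq> set (take R il)}. (w j)\<^sup>2)"
      proof (rule sum_mono2)
        have "set (take (Suc r) il) \<subseteq> set (take R il)" if "r < R" for r
          using that by (intro set_take_subset_set_take) simp
        then show "(\<Union>r<R. E r) \<subseteq> {j\<in>J. S j \<subseteq> set (take R il)}"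
          unfolding E_def by blast
      qed (use \<open>finite J\<close> in auto)
      also have "\<dots> \<le> K * card (set (take R il))"
        by (rule w) (use set_take_subset il in fastforce)
      also have "card (set (take R il)) = R" using il R by (simp add: distinct_card n_def)
      finally have W: "(\<Sum>r<R. W r) \<le> K * R" .
      \<comment> \<open>Cauchy-Schwarz against the constant 1 yields (sum v)^2 \<le> K R *
        R.\<close>
      have "(\<Sum>r<R. v r)\<^sup>2 \<le> (\<Sum>r<R. (v r)\<^sup>2) * R"
        using sum_squared_le_sum_of_squares[of v "{..<R}"] by simp
      also have "\<dots> = (\<Sum>r<R. W r) * R" using W0 by (simp add: v_def)
      also have "\<dots> \<le> K * R * R" using W by (intro mult_right_mono) auto
      also have "\<dots> = (R * sqrt K)\<^sup>2" using \<open>K \<ge> 0\<close> by (simp add: power_mult_distrib power2_eq_square)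
      finally have "(\<Sum>r<R. v r) \<le> R * sqrt K" 
        by (rule power2_le_imp_le) (use \<open>K \<ge> 0\<close> in simp)
      then show "0 \<le> (\<Sum>r<R. sqrt K - v r)" by (simp add: sum_subtractf)
    qed (use desc in auto)
    then show ?thesis by (simp add: algebra_simps sum_subtractf)
  qed
  also have "\<dots> = sqrt K * (\<Sum>i\<in>I. g i)"
  proof -
    have "bij_betw ((!) il) {..<n} I" using il by (simp add: bij_betw_nth n_def)
    from sum.reindex_bij_betw[OF this, of g] show ?thesis
      by (simp add: mult.commute flip: sum_distrib_left)
  qed
  finally show ?thesis by (simp add: g_def)
qed

text \<open>For x = k / (k + 1) \<le> 1 and \<alpha> \<le> 1 one has x \<le> x^\<alpha>, so 1 -
  x^\<alpha> \<le> 1 / (k + 1); multiplying by (k + 1)^\<alpha> gives the bound.\<close>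

lemma powr_diff_le_powr_minus_one:
  fixes \<alpha> :: real
  assumes "0 < \<alpha>" "\<alpha> \<le> 1"
  shows "real (k + 1) powr \<alpha> - real k powr \<alpha> \<le> real (k + 1) powr (\<alpha> - 1)"
proof (cases "k = 0")
  case False
  define x where "x = real k / real (k + 1)"
  have x: "0 < x" "x \<le> 1" using False by (auto simp: x_def)
  have "x \<le> x powr \<alpha>" using powr_mono'[of \<alpha> 1 x] x assms by simp
  then have "1 - x powr \<alpha> \<le> 1 / real (k + 1)" by (simp add: x_def field_simps)
  then have "real (k + 1) powr \<alpha> * (1 - x powr \<alpha>) \<le> real (k + 1) powr \<alpha> * (1 / real (k + 1))"
    by (intro mult_left_mono) auto
  moreover have "real (k + 1) powr \<alpha> * x powr \<alpha> = real k powr \<alpha>"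
    by (subst powr_mult[symmetric]) (auto simp: x_def)
  moreover have "real (k + 1) powr \<alpha> * (1 / real (k + 1)) = real (k + 1) powr (\<alpha> - 1)"
    by (simp add: powr_diff)
  ultimately show ?thesis by (simp add: right_diff_distrib)
qed (use assms in simp)

text \<open>With y = N + 1 the induction step is N^(1/m) \<le> y^(1/m) - y^(1/m - 1) / m. This is
  the m-th root of Bernoulli's inequality (1 - 1/(m y))^m \<ge> 1 - 1/y, scaled by y^(1/m).\<close>

lemma sum_powr_le_powr:
  fixes m :: nat
  assumes "m \<ge> 1"
  shows "(\<Sum>k<N. real (k + 1) powr (1 / m - 1)) \<le> m * real N powr (1 / m)"
proof (induction N)
  case (Suc N)
  define y where "y = real (N + 1)"
  have y: "y \<ge> 1" by (simp add: y_def)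
  have pow: "(x ^ m) powr (1 / m) = x" if "x \<ge> 0" for x :: real
  proof (cases "x = 0")
    case False
    then have "x ^ m = x powr m" using that by (simp add: powr_realpow)
    then show ?thesis using that assms by (simp add: powr_powr)
  qed (use assms in simp)
  have nn: "0 \<le> 1 - 1 / (m * y)" using assms y mult_mono[of 1 "real m" 1 y] by (simp add: field_simps)
  have "(1 - 1 / (m * y)) ^ m \<ge> 1 + real m * (- (1 / (m * y)))"
    using Bernoulli_inequality[of "- (1 / (m * y))" m] nn by simp
  then have B: "1 - 1 / y \<le> (1 - 1 / (m * y)) ^ m" using assms y by simp
  have "(1 - 1 / y) powr (1 / m) \<le> ((1 - 1 / (m * y)) ^ m) powr (1 / m)"
    using B y by (intro powr_mono2) auto
  also have "\<dots> = 1 - 1 / (m * y)"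
    using pow[OF nn] .
  finally have "y powr (1 / m) * (1 - 1 / y) powr (1 / m) \<le> y powr (1 / m) * (1 - 1 / (m * y))"
    by (intro mult_left_mono) auto
  moreover have "y powr (1 / m) * (1 - 1 / y) powr (1 / m) = real N powr (1 / m)"
  proof -
    have "y * (1 - 1 / y) = real N" using y by (simp add: right_diff_distrib) (simp add: y_def)
    then show ?thesis using y by (subst powr_mult[symmetric]) auto
  qed
  ultimately have "real N powr (1 / m) \<le> y powr (1 / m) - y powr (1 / m - 1) / m"
    using y by (simp add: powr_diff field_simps)
  then have "m * real N powr (1 / m) \<le> m * y powr (1 / m) - y powr (1 / m - 1)"
    using assms by (simp add: field_simps)
  then show ?case using Suc by (simp add: y_def)
qed simp

text \<open>The Lorentz exponent enters here: \<alpha> = 1/p with p = 2m/(m+1) makes 2(\<alpha> - 1)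
  = 1/m - 1. The squared weights lie below a decreasing sequence, whose sum over A is at most that
  over an initial segment of the same size.\<close>

lemma sum_lorentz_weight_square_le:
  fixes m :: nat
  assumes "m \<ge> 1" "finite A" and \<alpha>: "\<alpha> = (real m + 1) / (2 * real m)"
  shows "(\<Sum>k\<in>A. (real (k + 1) powr \<alpha> - real k powr \<alpha>)\<^sup>2) \<le> m * real (card A) powr (1 / m)"
proof -
  have \<alpha>01: "0 < \<alpha>" "\<alpha> \<le> 1" using assms(1) by (simp_all add: \<alpha>)
  have \<alpha>2: "2 * (\<alpha> - 1) = 1 / m - 1" using assms by (simp add: field_simps)
  have "(\<Sum>k\<in>A. (real (k + 1) powr \<alpha> - real k powr \<alpha>)\<^sup>2) \<le> (\<Sum>k\<in>A. real (k + 1) powr (1 / m - 1))"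
  proof (rule sum_mono)
    fix k
    have "(real (k + 1) powr \<alpha> - real k powr \<alpha>)\<^sup>2 \<le> (real (k + 1) powr (\<alpha> - 1))\<^sup>2"
      using \<alpha>01 powr_diff_le_powr_minus_one[of \<alpha> k] powr_mono2[of \<alpha> "real k" "real (k + 1)"]
      by (intro power_mono) auto
    also have "\<dots> = real (k + 1) powr (1 / m - 1)"
      unfolding \<alpha>2[symmetric] power2_eq_square powr_add[symmetric] by simp
    finally show "(real (k + 1) powr \<alpha> - real k powr \<alpha>)\<^sup>2 \<le> real (k + 1) powr (1 / m - 1)" .
  qed
  also have "\<dots> \<le> (\<Sum>k<card A. real (k + 1) powr (1 / m - 1))"
    using assms by (intro antitone_sum_le_initial_segment) (auto simp: antimono_def intro!: powr_mono2')
  also have "\<dots> \<le> m * real (card A) powr (1 / m)"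
    by (rule sum_powr_le_powr[OF assms(1)])
  finally show ?thesis .
qed

text \<open>Sorting the index set by decreasing modulus realises the rearrangement and attaches each
  weight to an actual index.\<close>

lemma lorentz_p1_norm_enumeration:
  assumes "finite I"
  obtains js where "distinct js" "set js = I"
    "lorentz_p1_norm p I x =
      (\<Sum>k<length js. cmod (x (js ! k)) * (real (k + 1) powr (1 / p) - real k powr (1 / p)))"
proof -
  obtain l where l: "set l = I" "distinct l" using finite_distinct_list[OF assms] by blast
  define js where "js = rev (sort_key (\<lambda>i. cmod (x i)) l)"
  have "mset_set I = mset l" using mset_set_set[OF l(2)] l(1) by simp
  then have "decr_rearr I x = rev (sort (map (\<lambda>i. cmod (x i)) l))"
    by (simp add: decr_rearr_def flip: mset_map)
  also have "sort (map (\<lambda>i. cmod (x i)) l) = map (\<lambda>i. cmod (x i)) (sort_key (\<lambda>i. cmod (x i)) l)"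
    by (rule properties_for_sort) simp_all
  finally have dr: "decr_rearr I x = map (\<lambda>i. cmod (x i)) js" by (simp add: js_def rev_map)
  show thesis
    by (rule that[of js]) (use l in \<open>simp_all add: js_def[symmetric] lorentz_p1_norm_def dr\<close>, simp_all add: js_def)
qed

section \<open>Translation between sorted index lists and multisets\<close>

lemma finite_J_idx: "finite (J_idx m n)"
  using finite_lists_length_eq[of "{1..n}" m]
  by (rule finite_subset[rotated]) (auto simp: J_idx_def)

text \<open>The sum of all |c_j| bounds the values on the polydisc, so the supremum is a genuine
  upper bound.\<close>

lemma cmod_hom_poly_le_poly_sup_norm:
  assumes "\<And>i. i \<in> {1..n} \<Longrightarrow> cmod (z i) \<le> 1"
  shows "cmod (hom_poly m n c z) \<le> poly_sup_norm m n c"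
  unfolding poly_sup_norm_def
proof (rule cSUP_upper)
  show "bdd_above ((\<lambda>z. cmod (hom_poly m n c z)) ` {z. \<forall>i\<in>{1..n}. cmod (z i) \<le> 1})"
  proof (rule bdd_aboveI2)
    fix z :: "nat \<Rightarrow> complex" assume z: "z \<in> {z. \<forall>i\<in>{1..n}. cmod (z i) \<le> 1}"
    show "cmod (hom_poly m n c z) \<le> (\<Sum>j\<in>J_idx m n. cmod (c j))"
      unfolding hom_poly_def
    proof (rule sum_norm_le)
      fix j assume j: "j \<in> J_idx m n"
      have "cmod (\<Prod>k<m. z (j ! k)) \<le> 1"
        unfolding prod_norm[symmetric]
      proof (intro prod_le_1 conjI)
        fix k assume "k \<in> {..<m}"
        then have "j ! k \<in> {1..n}" using j nth_mem[of k j] unfolding J_idx_def by blast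
        then show "cmod (z (j ! k)) \<le> 1" using z by blast
      qed simp
      then show "cmod (c j * (\<Prod>k<m. z (j ! k))) \<le> cmod (c j)"
        by (simp add: norm_mult mult_left_le)
    qed
  qed
qed (use assms in auto)

text \<open>Sorted lists are canonical representatives of multisets.\<close>

lemma bij_betw_mset_J_idx: "bij_betw mset (J_idx m n) (multisets_of_size {1..n} m)"
  by (rule bij_betwI[where g = sorted_list_of_multiset])
     (auto simp: J_idx_def multisets_of_size_def sorted_sort_id sorted_list_of_multiset_mset
       simp flip: size_mset)

lemma hom_poly_eq_sum_multisets:
  "hom_poly m n c z = (\<Sum>M\<in>multisets_of_size {1..n} m. c (sorted_list_of_multiset M) * (\<Prod>i\<in>#M. z i))"
proof -
  have "(\<Sum>M\<in>multisets_of_size {1..n} m. c (sorted_list_of_multiset M) * (\<Prod>i\<in>#M. z i)) =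
    (\<Sum>j\<in>J_idx m n. c (sorted_list_of_multiset (mset j)) * (\<Prod>i\<in>#mset j. z i))"
    by (rule sum.reindex_bij_betw[OF bij_betw_mset_J_idx, symmetric])
  also have "\<dots> = hom_poly m n c z"
    unfolding hom_poly_def
  proof (intro sum.cong refl arg_cong2[where f = times])
    fix j assume j: "j \<in> J_idx m n"
    then show "c (sorted_list_of_multiset (mset j)) = c j"
      by (simp add: J_idx_def sorted_sort_id)
    have "(\<Prod>i\<in>#mset j. z i) = prod_list (map z j)" by (simp add: prod_mset_prod_list flip: mset_map)
    also have "\<dots> = (\<Prod>k<m. z (j ! k))"
      using j by (simp add: prod.list_conv_set_nth J_idx_def atLeast0LessThan)
    finally show "(\<Prod>i\<in>#mset j. z i) = (\<Prod>k<m. z (j ! k))" .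
  qed
  finally show ?thesis by simp
qed

lemma sum_sliced_L2_le_poly_sup_norm:
  "(\<Sum>i\<in>{1..n}. sqrt (\<Sum>j\<in>{j\<in>J_idx (Suc k) n. i \<in> set j}. (cmod (c j))\<^sup>2)) \<le> 2 * 4 ^ k * poly_sup_norm (Suc k) n c"
proof -
  have "(\<Sum>j\<in>{j\<in>J_idx (Suc k) n. i \<in> set j}. (cmod (c j))\<^sup>2) =
      (\<Sum>M\<in>{M\<in>multisets_of_size {1..n} (Suc k). i \<in># M}. (cmod (c (sorted_list_of_multiset M)))\<^sup>2)" for i
  proof -
    have "bij_betw mset {j\<in>J_idx (Suc k) n. i \<in> set j} {M\<in>multisets_of_size {1..n} (Suc k). i \<in># M}"
      using bij_betw_mset_J_idx by (rule bij_betw_Collect) simp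
    from sum.reindex_bij_betw[OF this, of "\<lambda>M. (cmod (c (sorted_list_of_multiset M)))\<^sup>2", symmetric]
    show ?thesis by (simp add: J_idx_def sorted_sort_id)
  qed
  then show ?thesis
    using sum_sliced_L2_le_sup[where I = "{1..n}" and k = k and c = "\<lambda>M. c (sorted_list_of_multiset M)"
        and B = "poly_sup_norm (Suc k) n c"]
    by (simp only: cmod_hom_poly_le_poly_sup_norm finite_atLeastAtMost flip: hom_poly_eq_sum_multisets)
qed

section \<open>Combination of the Lorentz weight bound with the mixed norm estimate\<close>

theorem theorem5p1:
  fixes m :: nat
  assumes "m \<ge> 1"
  shows "\<exists>C>0. \<forall>n. \<forall>c :: nat list \<Rightarrow> complex.
           lorentz_p1_norm (2 * real m / (real m + 1)) (J_idx m n) c \<le> C * poly_sup_norm m n c"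
proof (intro exI conjI allI)
  define k where "k = m - 1"
  have m: "m = Suc k" using assms by (simp add: k_def)
  \<comment> \<open>The factor sqrt m comes from the weights, with K = m, and 2 * 4^(m-1) from the
    slice norms in degree m.\<close>
  show "0 < sqrt m * (2 * 4 ^ (m - 1))" using assms by simp
  fix n and c :: "nat list \<Rightarrow> complex"
  define p where "p = 2 * real m / (real m + 1)"
  define w where "w k = real (k + 1) powr (1 / p) - real k powr (1 / p)" for k :: nat
  have p: "1 / p = (real m + 1) / (2 * real m)" by (simp add: p_def)
  have w0: "w k \<ge> 0" for k
    unfolding w_def using powr_mono2[of "1 / p" "real k" "real (k + 1)"] by (simp add: p)
  obtain js where js: "distinct js" "set js = J_idx m n"
    and norm: "lorentz_p1_norm p (J_idx m n) c = (\<Sum>k<length js. cmod (c (js ! k)) * w k)"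
    unfolding w_def by (rule lorentz_p1_norm_enumeration[OF finite_J_idx])
  have J: "js ! r \<in> J_idx m n" if "r < length js" for r
    using that js(2) nth_mem by blast
  \<comment> \<open>The weights depend on the rank in \<open>js\<close>, so ranks r play the role of
    the indices, with S r = \<open>set (js ! r)\<close>.\<close>
  have "(\<Sum>k<length js. cmod (c (js ! k)) * w k) \<le>
    sqrt m * (\<Sum>i\<in>{1..n}. sqrt (\<Sum>r\<in>{r\<in>{..<length js}. i \<in> set (js ! r)}. (cmod (c (js ! r)))\<^sup>2))"
  proof (rule sum_mult_le_sum_sliced_L2)
    show "set (js ! r) \<noteq> {} \<and> set (js ! r) \<subseteq> {1..n}" if "r \<in> {..<length js}" for r
      using J[of r] that m by (auto simp: J_idx_def)
    fix U assume U: "U \<subseteq> {1..n}"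
    define A where "A = {r\<in>{..<length js}. set (js ! r) \<subseteq> U}"
    have finU: "finite U" using U finite_subset by blast
    \<comment> \<open>Ranks whose index uses only variables in U inject into the m-tuples over U,
      since \<open>js\<close> is distinct.\<close>
    have "card A \<le> card {xs. set xs \<subseteq> U \<and> length xs = m}"
    proof (rule card_inj_on_le)
      show "inj_on ((!) js) A" using js(1) by (auto simp: inj_on_def A_def nth_eq_iff_index_eq)
      show "(!) js ` A \<subseteq> {xs. set xs \<subseteq> U \<and> length xs = m}" using J by (auto simp: A_def J_idx_def)
      show "finite {xs. set xs \<subseteq> U \<and> length xs = m}" using finU by (rule finite_lists_length_eq)
    qed
    also have "\<dots> = card U ^ m" using finU by (rule card_lists_length_eq)
    finally have cardA: "real (card A) \<le> real (card U) ^ m" by (metis of_nat_le_iff of_nat_power)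
    have "(\<Sum>r\<in>A. (w r)\<^sup>2) \<le> m * real (card A) powr (1 / m)"
      unfolding w_def using assms p by (intro sum_lorentz_weight_square_le) (auto simp: A_def)
    also have "\<dots> \<le> m * (real (card U) ^ m) powr (1 / m)"
      using cardA by (intro mult_left_mono powr_mono2) auto
    \<comment> \<open>The root from the weight bound cancels the power from the count, leaving a
      bound linear in \<open>card U\<close>.\<close>
    also have "(real (card U) ^ m) powr (1 / m) = card U"
    proof (cases "card U = 0")
      case False
      then show ?thesis using assms by (simp add: powr_powr flip: powr_realpow)
    qed (use assms in simp)
    finally show "(\<Sum>r\<in>{r\<in>{..<length js}. set (js ! r) \<subseteq> U}. (w r)\<^sup>2) \<le> real m * card U"
      by (simp add: A_def)
  qed (use w0 in auto)
  also have "\<dots> = sqrt m * (\<Sum>i\<in>{1..n}. sqrt (\<Sum>j\<in>{j\<in>J_idx m n. i \<in> set j}. (cmod (c j))\<^sup>2))"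
  proof -
    have "bij_betw ((!) js) {..<length js} (J_idx m n)" using js by (simp add: bij_betw_nth)
    then have "bij_betw ((!) js) {r\<in>{..<length js}. i \<in> set (js ! r)} {j\<in>J_idx m n. i \<in> set j}" for i
      by (rule bij_betw_Collect) simp
    from sum.reindex_bij_betw[OF this, of "\<lambda>j. (cmod (c j))\<^sup>2"] show ?thesis by simp
  qed
  also have "\<dots> \<le> sqrt m * (2 * 4 ^ (m - 1) * poly_sup_norm m n c)"
    using sum_sliced_L2_le_poly_sup_norm[where n = n and k = k and c = c] by (intro mult_left_mono) (simp_all add: m)
  finally show "lorentz_p1_norm (2 * real m / (real m + 1)) (J_idx m n) c
      \<le> sqrt m * (2 * 4 ^ (m - 1)) * poly_sup_norm m n c"
    using norm by (simp add: p_def mult_ac)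
qed

end
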